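(* Let $n\ge 3$ and $k$ be integers with $n\ge k\ge 0$, let $G\in\mathcal{C}_n^k$, and put $\gamma=\frac{k-2}{n-k}$. Then $$\prod\nolimits_{2}(G)\;\ge\;\begin{cases}3^{3k}\,2^{2(n-2k)} & \text{if } k\in\{0,1\},\\[2pt] (2+\lceil\gamma\rceil)^{(2+\lceil\gamma\rceil)\,[k-2-\lfloor\gamma\rfloor(n-k)]}\;(2+\lfloor\gamma\rfloor)^{(2+\lfloor\gamma\rfloor)\,[n-2k+2+\lfloor\gamma\rfloor(n-k)]} & \text{if } k\ge 2.\end{cases}$$ For $k\in\{0,1\}$, equality holds if and only if the degree sequence of $G$ is $\underbrace{3,\dots,3}_{k},\underbrace{2,\dots,2}_{n-2k},\underbrace{1,\dots,1}_{k}$. For $k\ge 2$, equality holds if and only if the degree sequence of $G$ is $$\underbrace{2+\lceil\gamma\rceil,\dots,2+\lceil\gamma\rceil}_{k-2-\lfloor\gamma\rfloor(n-k)},\ \underbrace{2+\lfloor\gamma\rfloor,\dots,2+\lfloor\gamma\rfloor}_{n-2k+2+\lfloor\gamma\rfloor(n-k)},\ \underbrace{1,\dots,1}_{k}.$$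
   Context: All graphs are finite, simple and connected. A cactus is a connected graph all of whose blocks are edges or cycles; equivalently, any two distinct cycles have at most one vertex in common (trees are cacti). A pendant vertex is a vertex of degree $1$. For $n\ge k\ge 0$, $\mathcal{C}_n^k$ denotes the set of cactus graphs with $n$ vertices of which exactly $k$ are pendant vertices. The second multiplicative Zagreb index is $\prod_2(G)=\prod_{uv\in E(G)}d(u)d(v)=\prod_{v\in V(G)}d(v)^{d(v)}$, where $d(v)$ is the degree of $v$. Degree sequences are considered up to order. *)

theory Defs
  imports
    Complex_Main
    "HOL-Library.Multiset"
    "Graph_Theory.Digraph_Component"
begin

text \<open>
  A finite simple graph is a finite, symmetric, loop-free digraph without parallel arcs
  (locale \<^locale>\<open>graph\<close>): the undirected edge \<open>uv\<close> is the pair of arcs \<open>u \<rightarrow> v\<close>, \<open>v \<rightarrow> u\<close>.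
  Hence \<^const>\<open>out_degree\<close> is the usual degree of a vertex.
\<close>

abbreviation deg :: "('a, 'b) pre_digraph \<Rightarrow> 'a \<Rightarrow> nat" where
  "deg G v \<equiv> out_degree G v"

definition edges :: "('a, 'b) pre_digraph \<Rightarrow> 'a set set" where
  "edges G = {{u, v} | u v. (u, v) \<in> arcs_ends G}"

definition second_mult_zagreb :: "('a, 'b) pre_digraph \<Rightarrow> nat" where
  "second_mult_zagreb G = (\<Prod>e \<in> edges G. \<Prod>v \<in> e. deg G v)"

definition degree_sequence :: "('a, 'b) pre_digraph \<Rightarrow> nat multiset" where
  "degree_sequence G = image_mset (deg G) (mset_set (verts G))"

definition pendant_vertices :: "('a, 'b) pre_digraph \<Rightarrow> 'a set" where
  "pendant_vertices G = {v \<in> verts G. deg G v = 1}"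

text \<open>
  A cut vertex separates two other vertices of its component. It is not defined as a vertex whose
  deletion leaves a graph that is not \<^const>\<open>connected\<close>, because the null graph is not
  \<^const>\<open>connected\<close>, and so the vertex of a one-vertex graph would be a cut vertex.
\<close>

definition cut_vertex :: "('a, 'b) pre_digraph \<Rightarrow> 'a \<Rightarrow> bool" where
  "cut_vertex G v \<longleftrightarrow> v \<in> verts G \<and>
     (\<exists>a \<in> verts G - {v}. \<exists>b \<in> verts G - {v}.
        a \<rightarrow>\<^sup>*\<^bsub>G\<^esub> b \<and> \<not> a \<rightarrow>\<^sup>*\<^bsub>pre_digraph.del_vert G v\<^esub> b)"

text \<open>
  Requiring \<^const>\<open>graph\<close> of a block makes it an undirected subgraph: with every arc it also
  contains the reverse arc.
\<close>

definition is_block :: "('a, 'b) pre_digraph \<Rightarrow> ('a, 'b) pre_digraph \<Rightarrow> bool" where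
  "is_block G B \<longleftrightarrow>
     pre_digraph.max_subgraph G (\<lambda>H. graph H \<and> connected H \<and> (\<forall>v. \<not> cut_vertex H v)) B"

definition is_edge_graph :: "('a, 'b) pre_digraph \<Rightarrow> bool" where
  "is_edge_graph H \<longleftrightarrow> graph H \<and> (\<exists>u v. u \<noteq> v \<and> verts H = {u, v} \<and> edges H = {{u, v}})"

definition is_cycle_graph :: "('a, 'b) pre_digraph \<Rightarrow> bool" where
  "is_cycle_graph H \<longleftrightarrow> graph H \<and>
     (\<exists>vs. distinct vs \<and> length vs \<ge> 3 \<and> verts H = set vs \<and>
        edges H = {{vs ! i, vs ! (Suc i mod length vs)} | i. i < length vs})"

definition cactus :: "('a, 'b) pre_digraph \<Rightarrow> bool" where
  "cactus G \<longleftrightarrow> graph G \<and> connected G \<and>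
     (\<forall>B. is_block G B \<longrightarrow> is_edge_graph B \<or> is_cycle_graph B)"

definition cacti :: "nat \<Rightarrow> nat \<Rightarrow> ('a, 'b) pre_digraph set" where
  "cacti n k = {G. cactus G \<and> card (verts G) = n \<and> card (pendant_vertices G) = k}"

end

(* Each pendant vertex contributes the factor 1, so only the degrees of the n - k other vertices
   matter. Connectedness bounds their sum below by 2 (n - 1) - k; for k <= 1 the fact that they are
   at least 2, together with the handshake lemma, does better. The map d |-> d ln d is strictly
   convex, so its values at positive integers lie above the line through its values at p and p + 1,
   with equality only at p and p + 1. Summing this bound over the non-pendant vertices, with p the
   integer part of the least possible average degree, gives the inequality and its equality case. *)

theory Submission
  imports Defs
begin

section \<open>Strict convexity of \<open>m * ln m\<close> and balanced products of
  self-powers\<close>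

text \<open>The function \<open>x * ln x\<close> lies strictly above its tangent at
  \<open>m + 1\<close>. Evaluating this at \<open>m\<close> and at \<open>m + 2\<close> and adding
  cancels the slope terms.\<close>

lemma ln_self_second_difference:
  fixes m :: nat
  assumes "m \<ge> 1"
  shows "2 * (real (m + 1) * ln (real (m + 1)))
    < real m * ln (real m) + real (m + 2) * ln (real (m + 2))"
proof -
  \<comment> \<open>After cancellation this reads \<open>x * ln (y / x) < y - x\<close>, that is,
    \<open>ln t < t - 1\<close> at \<open>t = y / x \<noteq> 1\<close>.\<close>
  have tangent: "y * ln y + (ln y + 1) * (x - y) < x * ln x" if "x > 0" "y > 0" "x \<noteq> y" for x y :: real
  proof -
    have "ln (y / x) < y / x - 1"
      using that ln_le_minus_one[of "y / x"] ln_eq_minus_one[of "y / x"] by fastforce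
    then have "x * (ln y - ln x) < x * (y / x - 1)"
      using that by (simp add: ln_div)
    then show ?thesis
      using that by (simp add: algebra_simps)
  qed
  show ?thesis
    using tangent[of "real m" "real (m + 1)"] tangent[of "real (m + 2)" "real (m + 1)"] assms
    by (simp add: algebra_simps)
qed

text \<open>The increments of \<open>g\<close> increase strictly, so outside the interval from
  \<open>p\<close> to \<open>p + 1\<close> the graph of \<open>g\<close> bends away above the line
  through its values there. Convexity is assumed from 1 on only, so the value \<open>g 0\<close>
  never enters.\<close>

lemma discrete_strictly_convex_chord:
  fixes g :: "nat \<Rightarrow> real"
  assumes convex: "\<And>m. m \<ge> 1 \<Longrightarrow> 2 * g (m + 1) < g m + g (m + 2)"
    and "p \<ge> 1" "d \<ge> 1"
  shows "g p + (g (p + 1) - g p) * (real d - real p) \<le> g d"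
    and "g p + (g (p + 1) - g p) * (real d - real p) = g d \<longleftrightarrow> d \<in> {p, p + 1}"
proof -
  define L where "L = g (p + 1) - g p"
  have slope: "g (i + 1) - g i < g (Suc (i + k) + 1) - g (Suc (i + k))" if "1 \<le> i" for i k
  proof (induction k)
    case 0
    show ?case using convex[OF that] by simp
  next
    case (Suc k)
    then show ?case using convex[of "Suc (i + k)"] by simp
  qed
  have above: "g p + L * (real (p + 2 + k) - real p) < g (p + 2 + k)" for k
  proof (induction k)
    case 0
    show ?case using convex[OF \<open>p \<ge> 1\<close>] by (simp add: L_def)
  next
    case (Suc k)
    then show ?case using slope[OF \<open>p \<ge> 1\<close>, of "Suc k"] by (simp add: L_def algebra_simps)
  qed
  \<comment> \<open>Here \<open>k\<close> counts steps down from \<open>p - 1\<close>. Stepping from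
    \<open>d + 1\<close> down to \<open>d\<close> lowers the line by \<open>L\<close> but
    \<open>g\<close> by less than \<open>L\<close>, so the gap persists.\<close>
  have below: "g p + L * (real d - real p) < g d" if "d + 1 + k = p" "d \<ge> 1" for d k
    using that
  proof (induction k arbitrary: d)
    case 0
    then show ?case using convex[of d] by (auto simp: L_def algebra_simps)
  next
    case (Suc k)
    have "g p + L * (real (d + 1) - real p) < g (d + 1)"
      using Suc.IH[of "d + 1"] Suc.prems by simp
    moreover have "g (d + 1) - g d < L"
      using slope[of d "Suc k"] Suc.prems unfolding L_def by (metis add.assoc add.commute plus_1_eq_Suc)
    ultimately show ?case by (simp add: algebra_simps)
  qed
  have strict: "g p + L * (real d - real p) < g d" if "d \<notin> {p, p + 1}"
  proof (cases "d < p")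
    case True
    then show ?thesis using below[of d "p - d - 1"] \<open>d \<ge> 1\<close> by simp
  next
    case False
    then have "p + 2 + (d - p - 2) = d" using that by auto
    with above[of "d - p - 2"] show ?thesis by metis
  qed
  have touch: "g p + L * (real d - real p) = g d" if "d \<in> {p, p + 1}"
    using that by (auto simp: L_def)
  show "g p + (g (p + 1) - g p) * (real d - real p) \<le> g d"
    and "g p + (g (p + 1) - g p) * (real d - real p) = g d \<longleftrightarrow> d \<in> {p, p + 1}"
    using strict touch unfolding L_def by fastforce+
qed

lemma count_image_mset_set:
  assumes "finite A"
  shows "count (image_mset f (mset_set A)) y = card {x \<in> A. f x = y}"
  using assms by (simp add: count_image_mset vimage_def Int_def conj_commute)

text \<open>In logarithms, \<open>T\<close> (the chord bound summed over \<open>A\<close>) lies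
  between \<open>ln bound\<close> and \<open>ln P\<close>. The lower estimate uses the size of the
  sum and the upper one convexity; equality of the outer terms forces equality in both.\<close>

lemma prod_self_power_balanced:
  fixes d :: "'a \<Rightarrow> nat"
  assumes fin: "finite A" and pos: "\<And>x. x \<in> A \<Longrightarrow> d x \<ge> 1" and p: "p \<ge> 1" and a: "a \<le> card A"
    and sum: "card A * p + a \<le> sum d A"
  defines "bound \<equiv> (p + 1) ^ ((p + 1) * a) * p ^ (p * (card A - a))"
  shows "bound \<le> (\<Prod>x\<in>A. d x ^ d x)"
    and "(\<Prod>x\<in>A. d x ^ d x) = bound \<longleftrightarrow>
      image_mset d (mset_set A) = replicate_mset a (p + 1) + replicate_mset (card A - a) p"
proof -
  define g where "g = (\<lambda>m::nat. real m * ln (real m))"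
  define L where "L = g (p + 1) - g p"
  define P where "P = (\<Prod>x\<in>A. d x ^ d x)"
  have convex: "2 * g (m + 1) < g m + g (m + 2)" if "m \<ge> 1" for m
    using ln_self_second_difference[OF that] by (simp add: g_def)
  note chord = discrete_strictly_convex_chord[of g, OF convex p, folded L_def]
  \<comment> \<open>The slope \<open>L\<close> is positive, so a lower bound on the sum of
    \<open>d\<close> becomes a lower bound on \<open>T\<close>.\<close>
  have "real p * ln (real p) \<le> real p * ln (real (p + 1))"
    using p by (intro mult_left_mono) auto
  moreover have "0 < ln (real (p + 1))" using p by simp
  moreover have "g (p + 1) = real p * ln (real (p + 1)) + ln (real (p + 1))"
    by (simp add: g_def algebra_simps)
  ultimately have "L > 0"
    unfolding L_def g_def by linarith
  have "P > 0" using pos unfolding P_def by (intro prod_pos) (auto simp: Suc_le_eq)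
  have "bound > 0" using p by (simp add: bound_def)
  have lnP: "ln (real P) = (\<Sum>x\<in>A. g (d x))"
    unfolding P_def g_def using pos fin
    by (simp add: ln_prod ln_realpow Suc_le_eq)
  \<comment> \<open>This is \<open>a * g (p + 1) + (card A - a) * g p\<close>, rearranged to match
    the form of \<open>T\<close>.\<close>
  have lnb: "ln (real bound) = card A * g p + L * a"
    using p a by (simp add: bound_def L_def g_def ln_mult ln_realpow algebra_simps)
  define T where "T = (\<Sum>x\<in>A. g p + L * (real (d x) - real p))"
  have T: "T = card A * g p + L * (real (sum d A) - card A * p)"
    by (simp add: T_def sum.distrib sum_distrib_left[symmetric] sum_subtractf)
  have le1: "ln (real bound) \<le> T"
  proof -
    have "real a \<le> real (sum d A) - real (card A * p)"
      using sum by linarith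
    then show ?thesis using \<open>L > 0\<close> unfolding T lnb by simp
  qed
  have le2: "T \<le> ln (real P)"
    unfolding T_def lnP using chord(1) pos by (intro sum_mono) auto
  have "ln (real bound) \<le> ln (real P)" using le1 le2 by simp
  then show "bound \<le> (\<Prod>x\<in>A. d x ^ d x)"
    using \<open>P > 0\<close> \<open>bound > 0\<close> unfolding P_def[symmetric] by simp
  show "(\<Prod>x\<in>A. d x ^ d x) = bound \<longleftrightarrow>
      image_mset d (mset_set A) = replicate_mset a (p + 1) + replicate_mset (card A - a) p"
    (is "?l \<longleftrightarrow> ?M = ?R")
  proof
    assume ?l
    then have eq: "ln (real P) = ln (real bound)" by (simp add: P_def)
    \<comment> \<open>Equality in the upper estimate must hold term by term, which leaves only the
      values \<open>p\<close> and \<open>p + 1\<close>.\<close>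
    have "T = (\<Sum>x\<in>A. g (d x))" using eq le1 le2 lnP by simp
    then have two: "d x \<in> {p, p + 1}" if "x \<in> A" for x
      using sum_mono_inv[of "\<lambda>x. g p + L * (real (d x) - real p)" A "\<lambda>x. g (d x)", OF _ _ that fin]
        chord pos that unfolding T_def by blast
    \<comment> \<open>Equality in the lower estimate fixes the sum, since \<open>L > 0\<close> can
      be divided out. The sum then determines how often \<open>p + 1\<close> occurs.\<close>
    have "T = ln (real bound)" using eq le1 le2 by simp
    then have "real (sum d A) = card A * p + a"
      using \<open>L > 0\<close> unfolding T lnb by simp
    then have total: "sum d A = card A * p + a" by linarith
    have "sum d A = (\<Sum>x\<in>A. p + (if d x = p + 1 then 1 else 0))"
      using two by (intro sum.cong) auto
    also have "\<dots> = card A * p + card {x\<in>A. d x = p + 1}"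
      using fin by (simp add: sum.distrib sum.If_cases Int_def)
    finally have up: "card {x\<in>A. d x = p + 1} = a" using total by simp
    have "A = {x\<in>A. d x = p} \<union> {x\<in>A. d x = p + 1}" using two by auto
    moreover have "card ({x\<in>A. d x = p} \<union> {x\<in>A. d x = p + 1}) =
        card {x\<in>A. d x = p} + card {x\<in>A. d x = p + 1}"
      using fin by (intro card_Un_disjoint) auto
    ultimately have "card A = card {x\<in>A. d x = p} + card {x\<in>A. d x = p + 1}"
      by (rule subst[of _ _ "\<lambda>X. card X = _", OF sym])
    then have low: "card {x\<in>A. d x = p} = card A - a" using up by simp
    show "?M = ?R"
    proof (rule multiset_eqI)
      fix y
      have "card {x \<in> A. d x = y} = 0" if "y \<notin> {p, p + 1}"
        using two that by (intro card_eq_0_iff[THEN iffD2] disjI1) auto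
      then show "count ?M y = count ?R y"
        using up low by (auto simp: count_image_mset_set[OF fin])
    qed
  next
    assume eq: "?M = ?R"
    \<comment> \<open>For the converse, the product depends only on the multiset of values.\<close>
    have "(\<Prod>x\<in>A. d x ^ d x) = prod_mset (image_mset (\<lambda>m. m ^ m) ?M)"
      by (simp add: prod_unfold_prod_mset multiset.map_comp comp_def)
    also have "\<dots> = bound"
      unfolding eq bound_def
      by (simp only: image_mset_union image_replicate_mset prod_mset.union prod_mset_replicate_mset
          power_mult)
    finally show ?l .
  qed
qed

section \<open>Edges, degrees and double counting\<close>

context graph
begin

lemma edge_iff_arcs_ends: "{u, v} \<in> edges G \<longleftrightarrow> (u, v) \<in> arcs_ends G"
  using sym_arcs by (auto simp: edges_def symmetric_def doubleton_eq_iff dest: symD)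

lemma arcs_ends_in_verts:
  assumes "(u, v) \<in> arcs_ends G"
  shows "u \<in> verts G" "v \<in> verts G" "u \<noteq> v"
  using assms no_loops by (auto simp: arcs_ends_def arc_to_ends_def)

lemma edges_subset_Pow: "edges G \<subseteq> Pow (verts G)"
  using arcs_ends_in_verts by (auto simp: edges_def)

lemma finite_edges: "finite (edges G)"
  using edges_subset_Pow by (rule finite_subset) simp

lemma card_edge: "e \<in> edges G \<Longrightarrow> card e = 2"
  using arcs_ends_in_verts by (auto simp: edges_def)

text \<open>Each arc leaving \<open>v\<close> is sent to its pair of ends. Arcs with the common tail
  \<open>v\<close> and equal pairs have equal heads, hence coincide as there are no parallel arcs;
  symmetry lets every edge at \<open>v\<close> be read as an arc leaving \<open>v\<close>.\<close>

lemma card_incident_edges: "card {e \<in> edges G. v \<in> e} = deg G v"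
proof -
  have "bij_betw (\<lambda>a. {tail G a, head G a}) (out_arcs G v) {e \<in> edges G. v \<in> e}"
    unfolding bij_betw_def
  proof (intro conjI inj_onI equalityI subsetI)
    fix a b
    assume "a \<in> out_arcs G v" "b \<in> out_arcs G v" "{tail G a, head G a} = {tail G b, head G b}"
    then have "a \<in> arcs G" "b \<in> arcs G" "arc_to_ends G a = arc_to_ends G b"
      by (auto simp: out_arcs_def arc_to_ends_def doubleton_eq_iff)
    then show "a = b" by (rule no_multi_arcs)
  next
    fix e assume "e \<in> (\<lambda>a. {tail G a, head G a}) ` out_arcs G v"
    then show "e \<in> {e \<in> edges G. v \<in> e}"
      by (auto simp: edge_iff_arcs_ends out_arcs_def arcs_ends_def arc_to_ends_def)
  next
    fix e assume "e \<in> {e \<in> edges G. v \<in> e}"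
    then obtain w where e: "e = {v, w}" "{v, w} \<in> edges G"
      unfolding edges_def by blast
    then obtain a where "a \<in> arcs G" "tail G a = v" "head G a = w"
      by (auto simp: edge_iff_arcs_ends arcs_ends_def arc_to_ends_def)
    then show "e \<in> (\<lambda>a. {tail G a, head G a}) ` out_arcs G v"
      using e by (auto simp: out_arcs_def)
  qed
  then show ?thesis
    by (simp add: bij_betw_same_card out_degree_def)
qed

text \<open>Incident pairs of a vertex and an edge are counted in both orders; each edge has two
  ends.\<close>

lemma handshake: "(\<Sum>v\<in>verts G. deg G v) = 2 * card (edges G)"
proof -
  have "(\<Sum>v\<in>verts G. deg G v) = (\<Sum>v\<in>verts G. \<Sum>e | e \<in> edges G \<and> v \<in> e. 1)"
    by (simp add: card_incident_edges)
  also have "\<dots> = (\<Sum>e\<in>edges G. \<Sum>v | v \<in> verts G \<and> v \<in> e. 1)"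
    using finite_edges by (intro sum.swap_restrict) auto
  also have "\<dots> = (\<Sum>e\<in>edges G. (2::nat))"
  proof (rule sum.cong[OF refl])
    fix e assume "e \<in> edges G"
    then have "{v. v \<in> verts G \<and> v \<in> e} = e" using edges_subset_Pow by auto
    then show "(\<Sum>v | v \<in> verts G \<and> v \<in> e. 1) = (2::nat)" using card_edge[OF \<open>e \<in> edges G\<close>] by simp
  qed
  finally show ?thesis by simp
qed

text \<open>Exchanging the two products makes \<open>deg G v\<close> appear once for each edge at
  \<open>v\<close>.\<close>

lemma second_mult_zagreb_eq: "second_mult_zagreb G = (\<Prod>v\<in>verts G. deg G v ^ deg G v)"
proof -
  have "second_mult_zagreb G = (\<Prod>e\<in>edges G. \<Prod>v | v \<in> verts G \<and> v \<in> e. deg G v)"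
    unfolding second_mult_zagreb_def using edges_subset_Pow
    by (intro prod.cong refl) auto
  also have "\<dots> = (\<Prod>v\<in>verts G. \<Prod>e | e \<in> edges G \<and> v \<in> e. deg G v)"
    using finite_edges by (intro prod.swap_restrict) auto
  finally show ?thesis by (simp add: card_incident_edges)
qed

section \<open>Consequences of connectedness\<close>

text \<open>If no arc left \<open>S\<close>, then \<open>S\<close> would be closed under
  reachability, while symmetry and connectedness make every vertex reachable from
  \<open>S\<close>.\<close>

lemma connected_boundary_arc:
  assumes "connected G" "S \<subseteq> verts G" "S \<noteq> {}" "S \<noteq> verts G"
  obtains u v where "u \<in> S" "v \<in> verts G - S" "(u, v) \<in> arcs_ends G"
proof (rule ccontr)
  assume "\<not> thesis"
  with that have closed: "v \<in> S" if "u \<in> S" "(u, v) \<in> arcs_ends G" for u v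
    using arcs_ends_in_verts \<open>u \<in> S\<close> \<open>(u, v) \<in> arcs_ends G\<close> by blast
  obtain s t where "s \<in> S" "t \<in> verts G - S" using assms by auto
  moreover have "strongly_connected G"
    using assms(1) sym_arcs by (intro symmetric_connected_imp_strongly_connected)
  ultimately have "s \<rightarrow>\<^sup>* t" using assms(2) by auto
  then have "t \<in> S"
    using \<open>s \<in> S\<close> closed by (induction rule: reachable_induct) auto
  then show False using \<open>t \<in> verts G - S\<close> by simp
qed

text \<open>A vertex set is grown from a single vertex along boundary arcs; each added vertex brings
  at least one new edge.\<close>

lemma connected_card_edges:
  assumes "connected G"
  shows "card (verts G) \<le> card (edges G) + 1"
proof -
  have grow: "\<exists>S\<subseteq>verts G. card S = j + 1 \<and> j \<le> card {e \<in> edges G. e \<subseteq> S}"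
    if "j < card (verts G)" for j
    using that
  proof (induction j)
    case 0
    then obtain v where "v \<in> verts G" by fastforce
    then show ?case by (intro exI[of _ "{v}"]) auto
  next
    case (Suc j)
    then obtain S where S: "S \<subseteq> verts G" "card S = j + 1" "j \<le> card {e \<in> edges G. e \<subseteq> S}"
      by auto
    with Suc.prems have "S \<noteq> {}" "S \<noteq> verts G" by auto
    then obtain u v where uv: "u \<in> S" "v \<in> verts G - S" "(u, v) \<in> arcs_ends G"
      using connected_boundary_arc[OF assms S(1)] by metis
    have "finite S" using S(1) finite_subset finite_verts by metis
    \<comment> \<open>The edge \<open>{u, v}\<close> is new because \<open>v\<close> lies outside
      \<open>S\<close>.\<close>
    have "insert {u, v} {e \<in> edges G. e \<subseteq> S} \<subseteq> {e \<in> edges G. e \<subseteq> insert v S}"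
      using uv by (auto simp: edge_iff_arcs_ends)
    then have "card (insert {u, v} {e \<in> edges G. e \<subseteq> S}) \<le> card {e \<in> edges G. e \<subseteq> insert v S}"
      using finite_edges by (intro card_mono) auto
    moreover have "card (insert {u, v} {e \<in> edges G. e \<subseteq> S}) = Suc (card {e \<in> edges G. e \<subseteq> S})"
      using uv finite_edges by (intro card_insert_disjoint) auto
    ultimately show ?case
      using S uv \<open>finite S\<close> by (intro exI[of _ "insert v S"]) auto
  qed
  \<comment> \<open>Subtraction truncates at 0, so
    \<open>card (verts G) - 1 < card (verts G)\<close> requires a vertex.\<close>
  have "verts G \<noteq> {}" using assms by (auto simp: connected_def strongly_connected_def)
  then have "card (verts G) - 1 < card (verts G)" by (simp add: card_gt_0_iff)
  from grow[OF this] obtain S where "card (verts G) - 1 \<le> card {e \<in> edges G. e \<subseteq> S}" by auto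
  also have "\<dots> \<le> card (edges G)" using finite_edges by (intro card_mono) auto
  finally show ?thesis by simp
qed

text \<open>The set \<open>{v}\<close> is a proper nonempty subset, so a boundary arc leaves
  it.\<close>

lemma connected_deg_pos:
  assumes "connected G" "card (verts G) \<ge> 2" "v \<in> verts G"
  shows "deg G v \<ge> 1"
proof -
  have "card {v} < card (verts G)" using assms(2) by simp
  then have "{v} \<noteq> verts G" by (metis less_irrefl)
  then obtain w where "(v, w) \<in> arcs_ends G"
    using connected_boundary_arc[OF assms(1), of "{v}"] assms(3) by auto
  then have "{v, w} \<in> {e \<in> edges G. v \<in> e}" by (simp add: edge_iff_arcs_ends)
  then have "card {e \<in> edges G. v \<in> e} > 0"
    using finite_edges by (auto simp: card_gt_0_iff)
  then show ?thesis by (simp add: card_incident_edges)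
qed

section \<open>Splitting off the pendant vertices\<close>

text \<open>Pendant vertices contribute the factor 1 to the product and \<open>k\<close> to the
  degree sum, so the balanced bound applies to the other \<open>n - k\<close> vertices. The
  \<open>k\<close> ones are common to both degree sequences and cancel.\<close>

lemma second_mult_zagreb_balanced:
  assumes conn: "connected G" and n: "card (verts G) = n" "n \<ge> 2"
    and k: "card (pendant_vertices G) = k"
    and p: "p \<ge> 1" and a: "a \<le> n - k"
    and sum: "(n - k) * p + a + k \<le> 2 * card (edges G)"
  defines "bound \<equiv> (p + 1) ^ ((p + 1) * a) * p ^ (p * (n - k - a))"
  shows "bound \<le> second_mult_zagreb G"
    and "second_mult_zagreb G = bound \<longleftrightarrow> degree_sequence G =
      replicate_mset a (p + 1) + replicate_mset (n - k - a) p + replicate_mset k 1"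
proof -
  define N where "N = pendant_vertices G"
  define A where "A = verts G - N"
  have N: "N \<subseteq> verts G" "\<And>v. v \<in> N \<Longrightarrow> deg G v = 1"
    by (auto simp: N_def pendant_vertices_def)
  have fin: "finite N" "finite A" using N(1) by (auto simp: A_def intro: finite_subset)
  have split: "verts G = A \<union> N" "A \<inter> N = {}" using N(1) by (auto simp: A_def)
  have cardA: "card A = n - k"
    using N(1) n k fin by (simp add: A_def N_def card_Diff_subset)
  have pos: "1 \<le> deg G v" if "v \<in> A" for v
    using connected_deg_pos conn n that by (auto simp: A_def)
  have "(\<Sum>v\<in>verts G. deg G v) = (\<Sum>v\<in>A. deg G v) + k"
    using fin split N(2) k by (simp add: sum.union_disjoint N_def)
  then have sumA: "card A * p + a \<le> (\<Sum>v\<in>A. deg G v)"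
    using sum handshake cardA by simp
  have prodA: "second_mult_zagreb G = (\<Prod>v\<in>A. deg G v ^ deg G v)"
    using fin split N(2) by (simp add: second_mult_zagreb_eq prod.union_disjoint)
  have "image_mset (deg G) (mset_set N) = image_mset (\<lambda>_. 1) (mset_set N)"
    using N(2) fin by (intro image_mset_cong) simp
  also have "\<dots> = replicate_mset k 1"
    using k by (simp add: image_mset_const_eq N_def)
  finally have "image_mset (deg G) (mset_set N) = replicate_mset k 1" .
  then have seq: "degree_sequence G = image_mset (deg G) (mset_set A) + replicate_mset k 1"
    using fin split by (simp add: degree_sequence_def mset_set_Union)
  note balanced = prod_self_power_balanced[of A "deg G" p a, OF fin(2) pos p _ sumA]
  show "bound \<le> second_mult_zagreb G"
    using balanced(1) a by (simp add: bound_def prodA cardA)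
  show "second_mult_zagreb G = bound \<longleftrightarrow> degree_sequence G =
      replicate_mset a (p + 1) + replicate_mset (n - k - a) p + replicate_mset k 1"
    using balanced(2) a by (simp add: bound_def prodA cardA seq)
qed

text \<open>If all vertices were pendant, the degree sum would be \<open>card (verts G)\<close>,
  below the minimum \<open>2 * (card (verts G) - 1)\<close> once there are three vertices. This
  keeps the denominator of \<gamma> positive.\<close>

lemma connected_pendant_less:
  assumes "connected G" "card (verts G) \<ge> 3"
  shows "card (pendant_vertices G) < card (verts G)"
proof (rule ccontr)
  assume "\<not> ?thesis"
  moreover have sub: "pendant_vertices G \<subseteq> verts G" by (auto simp: pendant_vertices_def)
  ultimately have "pendant_vertices G = verts G"
    by (intro card_seteq) auto
  then have "deg G v = 1" if "v \<in> verts G" for v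
    using that by (auto simp: pendant_vertices_def)
  then have "(\<Sum>v\<in>verts G. deg G v) = card (verts G)"
    by simp
  then show False
    using handshake connected_card_edges[OF assms(1)] assms(2) by simp
qed

text \<open>A positive degree other than 1 is at least 2. For at most one pendant vertex this
  improves on the edge count of a tree.\<close>

lemma nonpendant_deg_sum:
  assumes "connected G" "card (verts G) \<ge> 2"
  shows "2 * (card (verts G) - card (pendant_vertices G)) + card (pendant_vertices G)
    \<le> 2 * card (edges G)"
proof -
  define N where "N = pendant_vertices G"
  have N: "N \<subseteq> verts G" "finite N"
    by (auto simp: N_def pendant_vertices_def)
  have "2 * card (verts G - N) \<le> (\<Sum>v\<in>verts G - N. deg G v)"
  proof -
    have "2 \<le> deg G v" if "v \<in> verts G - N" for v
      using connected_deg_pos[OF assms, of v] that by (auto simp: N_def pendant_vertices_def)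
    then show ?thesis
      using sum_bounded_below[of "verts G - N" 2 "deg G"] by simp
  qed
  moreover have "(\<Sum>v\<in>verts G. deg G v) = (\<Sum>v\<in>verts G - N. deg G v) + (\<Sum>v\<in>N. deg G v)"
    using N by (intro sum.subset_diff) auto
  moreover have "(\<Sum>v\<in>N. deg G v) = card N"
    by (simp add: N_def pendant_vertices_def)
  ultimately show ?thesis
    using N handshake by (simp add: N_def card_Diff_subset)
qed

end

section \<open>Integer form of the exponents and the two ranges of \<open>k\<close>\<close>

text \<open>Division with remainder turns the floor and ceiling of \<gamma> into a quotient and a
  test whether the remainder vanishes.\<close>

lemma floor_ceiling_div:
  fixes j m :: nat
  assumes "m > 0"
  shows "\<lfloor>real j / real m\<rfloor> = int (j div m)"
    and "\<lceil>real j / real m\<rceil> = int (j div m) + (if j mod m = 0 then 0 else 1)"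
proof -
  show "\<lfloor>real j / real m\<rfloor> = int (j div m)"
    by (simp add: floor_divide_of_nat_eq)
  have "real j = real m * real (j div m) + real (j mod m)"
    by (metis mult_div_mod_eq of_nat_add of_nat_mult)
  moreover have "real (j mod m) < real m" using assms by simp
  ultimately show "\<lceil>real j / real m\<rceil> = int (j div m) + (if j mod m = 0 then 0 else 1)"
    using assms by (intro ceiling_unique) (auto simp: field_simps)
qed

theorem theorem4:
  fixes n k :: nat and G :: "('a, 'b) pre_digraph" and \<gamma> :: real
  assumes "n \<ge> 3" and "n \<ge> k" and "G \<in> cacti n k"
    and "\<gamma> = (real k - 2) / (real n - real k)"
  shows
    "(k \<in> {0, 1} \<longrightarrow>
        real (second_mult_zagreb G) \<ge> 3 ^ (3 * k) * 2 powi (2 * (int n - 2 * int k)) \<and>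
        (real (second_mult_zagreb G) = 3 ^ (3 * k) * 2 powi (2 * (int n - 2 * int k)) \<longleftrightarrow>
         degree_sequence G =
           replicate_mset k 3 + replicate_mset (nat (int n - 2 * int k)) 2 + replicate_mset k 1))
   \<and> (k \<ge> 2 \<longrightarrow>
        real (second_mult_zagreb G) \<ge>
          of_int (2 + \<lceil>\<gamma>\<rceil>) powi ((2 + \<lceil>\<gamma>\<rceil>) * (int k - 2 - \<lfloor>\<gamma>\<rfloor> * (int n - int k))) *
          of_int (2 + \<lfloor>\<gamma>\<rfloor>) powi ((2 + \<lfloor>\<gamma>\<rfloor>) * (int n - 2 * int k + 2 + \<lfloor>\<gamma>\<rfloor> * (int n - int k))) \<and>
        (real (second_mult_zagreb G) =
          of_int (2 + \<lceil>\<gamma>\<rceil>) powi ((2 + \<lceil>\<gamma>\<rceil>) * (int k - 2 - \<lfloor>\<gamma>\<rfloor> * (int n - int k))) *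
          of_int (2 + \<lfloor>\<gamma>\<rfloor>) powi ((2 + \<lfloor>\<gamma>\<rfloor>) * (int n - 2 * int k + 2 + \<lfloor>\<gamma>\<rfloor> * (int n - int k))) \<longleftrightarrow>
         degree_sequence G =
           replicate_mset (nat (int k - 2 - \<lfloor>\<gamma>\<rfloor> * (int n - int k))) (nat (2 + \<lceil>\<gamma>\<rceil>)) +
           replicate_mset (nat (int n - 2 * int k + 2 + \<lfloor>\<gamma>\<rfloor> * (int n - int k))) (nat (2 + \<lfloor>\<gamma>\<rfloor>)) +
           replicate_mset k 1))"
proof -
  have "graph G" and conn: "connected G" and N: "card (verts G) = n" "card (pendant_vertices G) = k"
    using assms(3) by (auto simp: cacti_def cactus_def)
  interpret graph G by fact
  have "k < n" using connected_pendant_less[OF conn] N assms(1) by simp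
  have "n \<ge> 2" using assms(1) by simp
  note balanced = second_mult_zagreb_balanced[OF conn N(1) \<open>n \<ge> 2\<close> N(2)]
  have low: "2 * (n - k) + k \<le> 2 * card (edges G)"
    using nonpendant_deg_sum[OF conn] N \<open>n \<ge> 2\<close> by simp
  let ?Z = "second_mult_zagreb G"
  show ?thesis
  proof (intro conjI impI)
    assume "k \<in> {0, 1}"
    \<comment> \<open>For \<open>k = 1\<close> the bound \<open>low\<close> is odd while the degree sum is even.\<close>
    then have sum: "(n - k) * 2 + k + k \<le> 2 * card (edges G)"
      using low by (elim insertE emptyE) (simp, presburger)
    \<comment> \<open>Nonnegativity of \<open>n - 2 * k\<close> lets the integer exponent be read as
      a natural number.\<close>
    have le: "2 * k \<le> n" using \<open>k \<in> {0, 1}\<close> assms(1) by auto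
    have exps: "int n - 2 * int k = int (n - 2 * k)" "n - k - k = n - 2 * k"
      using le by auto
    define b :: nat where "b = 3 ^ (3 * k) * 2 ^ (2 * (n - 2 * k))"
    have b: "3 ^ (3 * k) * 2 powi (2 * (int n - 2 * int k)) = real b"
      unfolding exps b_def using power_int_of_nat[of "2::real" "2 * (n - 2 * k)"] by simp
    \<comment> \<open>The balanced level is \<open>p = 2\<close>, with \<open>k\<close> of the
      \<open>n - k\<close> non-pendant vertices raised to degree 3.\<close>
    note bal = balanced[of 2 k, OF _ _ sum, unfolded exps]
    have "b \<le> ?Z" "?Z = b \<longleftrightarrow> degree_sequence G =
        replicate_mset k 3 + replicate_mset (n - 2 * k) 2 + replicate_mset k 1"
      using bal le by (simp_all add: b_def)
    then show "real ?Z \<ge> 3 ^ (3 * k) * 2 powi (2 * (int n - 2 * int k))"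
      and "real ?Z = 3 ^ (3 * k) * 2 powi (2 * (int n - 2 * int k)) \<longleftrightarrow>
         degree_sequence G =
           replicate_mset k 3 + replicate_mset (nat (int n - 2 * int k)) 2 + replicate_mset k 1"
      unfolding b unfolding exps by simp_all
  next
    assume "k \<ge> 2"
    \<comment> \<open>The least possible degree sum over the \<open>m\<close> non-pendant vertices
      is \<open>2 * (n - 1) - k = 2 * m + (k - 2)\<close>. Dividing \<open>k - 2\<close> by
      \<open>m\<close> therefore gives the level \<open>2 + q\<close> and the number
      \<open>a\<close> of vertices one above it.\<close>
    define m where "m = n - k"
    define q where "q = (k - 2) div m"
    define a where "a = (k - 2) mod m"
    have "m > 0" using \<open>k < n\<close> by (simp add: m_def)
    have km: "k - 2 = m * q + a" by (simp add: q_def a_def)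
    have "a < m" using \<open>m > 0\<close> by (simp add: a_def)
    have \<gamma>: "\<gamma> = real (k - 2) / real m"
      using assms(4) \<open>k \<ge> 2\<close> \<open>k < n\<close> by (simp add: m_def)
    have fl: "\<lfloor>\<gamma>\<rfloor> = int q" and ce: "\<lceil>\<gamma>\<rceil> = int q + (if a = 0 then 0 else 1)"
      unfolding \<gamma> q_def a_def using floor_ceiling_div \<open>m > 0\<close> by blast+
    have nk: "int n = int k + int m" and k2: "int k = 2 + int m * int q + int a"
      using \<open>k < n\<close> \<open>k \<ge> 2\<close> arg_cong[OF km, of int] by (simp_all add: m_def)
    have e1: "int k - 2 - \<lfloor>\<gamma>\<rfloor> * (int n - int k) = int a"
      unfolding fl nk k2 by (simp add: algebra_simps)
    have e2: "int n - 2 * int k + 2 + \<lfloor>\<gamma>\<rfloor> * (int n - int k) = int (m - a)"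
      unfolding fl nk k2 using \<open>a < m\<close> by (simp add: algebra_simps)
    define b :: nat where "b = (2 + q + 1) ^ ((2 + q + 1) * a) * (2 + q) ^ ((2 + q) * (m - a))"
    \<comment> \<open>If \<open>a = 0\<close>, the ceiling is \<open>q\<close> instead of
      \<open>q + 1\<close> and the bases differ, but both exponents are 0.\<close>
    have f1: "of_int (2 + \<lceil>\<gamma>\<rceil>) powi ((2 + \<lceil>\<gamma>\<rceil>) * int a) = real ((2 + q + 1) ^ ((2 + q + 1) * a))"
    proof (cases "a = 0")
      case False
      then have "2 + \<lceil>\<gamma>\<rceil> = int (2 + q + 1)" by (simp add: ce)
      then show ?thesis
        by (simp only: of_nat_mult[symmetric] of_int_of_nat_eq power_int_of_nat of_nat_power)
    qed simp
    have f2: "of_int (2 + \<lfloor>\<gamma>\<rfloor>) powi ((2 + \<lfloor>\<gamma>\<rfloor>) * int (m - a)) = real ((2 + q) ^ ((2 + q) * (m - a)))"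
    proof -
      have "2 + \<lfloor>\<gamma>\<rfloor> = int (2 + q)" by (simp add: fl)
      then show ?thesis
        by (simp only: of_nat_mult[symmetric] of_int_of_nat_eq power_int_of_nat of_nat_power)
    qed
    have b: "of_int (2 + \<lceil>\<gamma>\<rceil>) powi ((2 + \<lceil>\<gamma>\<rceil>) * int a) *
        of_int (2 + \<lfloor>\<gamma>\<rfloor>) powi ((2 + \<lfloor>\<gamma>\<rfloor>) * int (m - a)) = real b"
      unfolding f1 f2 b_def by simp
    \<comment> \<open>Again the two values differ only when \<open>a = 0\<close>, where both
      multisets are empty.\<close>
    have r1: "replicate_mset a (nat (2 + \<lceil>\<gamma>\<rceil>)) = replicate_mset a (2 + q + 1)"
      by (cases "a = 0") (simp_all add: ce nat_add_distrib eval_nat_numeral)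
    have r2: "nat (2 + \<lfloor>\<gamma>\<rfloor>) = 2 + q" by (simp add: fl nat_add_distrib)
    \<comment> \<open>The left side equals \<open>2 * (n - 1)\<close>, twice the number of edges of
      a tree on \<open>n\<close> vertices.\<close>
    have "m * (2 + q) + a + k \<le> 2 * card (edges G)"
    proof -
      have "n = m + k" "k = m * q + a + 2" using \<open>k < n\<close> \<open>k \<ge> 2\<close> km by (simp_all add: m_def)
      then show ?thesis
        using connected_card_edges[OF conn] N(1) by (simp add: distrib_left)
    qed
    note bal = balanced[of "2 + q" a, OF _ _ this[unfolded m_def], folded m_def]
    have "b \<le> ?Z" "?Z = b \<longleftrightarrow> degree_sequence G =
        replicate_mset a (2 + q + 1) + replicate_mset (m - a) (2 + q) + replicate_mset k 1"
      using bal \<open>a < m\<close> unfolding b_def by simp_all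
    then show "real ?Z \<ge>
          of_int (2 + \<lceil>\<gamma>\<rceil>) powi ((2 + \<lceil>\<gamma>\<rceil>) * (int k - 2 - \<lfloor>\<gamma>\<rfloor> * (int n - int k))) *
          of_int (2 + \<lfloor>\<gamma>\<rfloor>) powi ((2 + \<lfloor>\<gamma>\<rfloor>) * (int n - 2 * int k + 2 + \<lfloor>\<gamma>\<rfloor> * (int n - int k)))"
      and "real ?Z =
          of_int (2 + \<lceil>\<gamma>\<rceil>) powi ((2 + \<lceil>\<gamma>\<rceil>) * (int k - 2 - \<lfloor>\<gamma>\<rfloor> * (int n - int k))) *
          of_int (2 + \<lfloor>\<gamma>\<rfloor>) powi ((2 + \<lfloor>\<gamma>\<rfloor>) * (int n - 2 * int k + 2 + \<lfloor>\<gamma>\<rfloor> * (int n - int k))) \<longleftrightarrow>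
         degree_sequence G =
           replicate_mset (nat (int k - 2 - \<lfloor>\<gamma>\<rfloor> * (int n - int k))) (nat (2 + \<lceil>\<gamma>\<rceil>)) +
           replicate_mset (nat (int n - 2 * int k + 2 + \<lfloor>\<gamma>\<rfloor> * (int n - int k))) (nat (2 + \<lfloor>\<gamma>\<rfloor>)) +
           replicate_mset k 1"
      unfolding e1 e2 b nat_int r1 r2 by simp_all
  qed
qed

end
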